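(* Let $P_0\succ P_1\succ\cdots\succ P_t$ be the chain of partitions induced by the ideal-load plateaus of $G$, and for each $i$ let $\lambda_i:=1/L_i$. Then $(P_0\succ\cdots\succ P_t)$ is a principal sequence of partitions with levels $A_i:=B_i$ and strictly increasing strengths $0<\lambda_1<\cdots<\lambda_t$; in particular, for every $i$, \[ |A_i|=\bigl(\kappa(P_i)-\kappa(P_{i-1})\bigr)\cdot\lambda_i . \] Moreover, each $\lambda_i$ equals the partition value $\Phi(H)$ of the induced subgraphs $H$ that are first split at level $i$ in the ideal-load recursion.
   Context: $G=(V,E)$ is a simple undirected graph. For a partition $P$ of a vertex set, $\kappa(P)$ is its number of parts and $E(H/P)$ is the set of edges of $H$ whose endpoints lie in different parts. For a graph $H$, $\Phi(H):=\min_P |E(H/P)|/(|P|-1)$ over partitions $P$ of $V(H)$ with at least two parts. Ideal relative loads $\ell^\star:E\to\mathbb{R}_{>0}$ are defined recursively: take a partition $P^\star$ of $V$ attaining $\Phi(G)$ (with each part inducing a connected subgraph), set $\ell^\star(e)=1/\Phi(G)$ for all $e\in E(G/P^\star)$, and recurse on each induced subgraph $G[S]$, $S\in P^\star$, to define $\ell^\star$ on edges internal to $S$; an induced subgraph $H$ arising in this recursion is "split at level $i$" when its crossing edges receive load $L_i$. Let $L_1>L_2>\cdots>L_t>0$ be the distinct values of $\ell^\star$, $B_i:=\{e\in E:\ell^\star(e)=L_i\}$, $A_{\le i}:=\bigcup_{q\le i}B_q$, $P_0:=\{V\}$, and $P_i$ the partition of $V$ into connected components of $G-A_{\le i}$.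 A principal sequence of partitions (PSP) is a chain $P_0\succ P_1\succ\cdots\succ P_t$ with strictly increasing strengths $0<\lambda_1<\cdots<\lambda_t$ such that $P_i$ is obtained from $P_{i-1}$ by deleting an edge set $A_i$ with $|A_i|=(\kappa(P_i)-\kappa(P_{i-1}))\lambda_i$.
   Formalization: The graph G is assumed finite and connected; for disconnected G one has Φ(G)=0, so 1/Φ(G) is undefined, and the identity fails at i=1 (two disjoint edges: |A_1|=2 but (κ(P_1)−κ(P_0))λ_1=3). *)

theory Defs
  imports Complex_Main "HOL-Library.Disjoint_Sets"
begin

text \<open>A graph is given by its vertex set and its set of edges, an edge being the
  two-element set of its endpoints.\<close>

definition simple_graph :: "'a set \<Rightarrow> 'a set set \<Rightarrow> bool" where
  "simple_graph V E \<longleftrightarrow> finite V \<and> (\<forall>e\<in>E. e \<subseteq> V \<and> card e = 2)"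

definition adj :: "'a set set \<Rightarrow> ('a \<times> 'a) set" where
  "adj E = {(u, v). {u, v} \<in> E}"

definition connected_graph :: "'a set \<Rightarrow> 'a set set \<Rightarrow> bool" where
  "connected_graph V E \<longleftrightarrow> V \<noteq> {} \<and> (\<forall>u\<in>V. \<forall>v\<in>V. (u, v) \<in> (adj E)\<^sup>*)"

definition conn_components :: "'a set \<Rightarrow> 'a set set \<Rightarrow> 'a set set" where
  "conn_components V E = V // ((adj E)\<^sup>* \<inter> V \<times> V)"

definition induced_edges :: "'a set set \<Rightarrow> 'a set \<Rightarrow> 'a set set" where
  "induced_edges E S = {e \<in> E. e \<subseteq> S}"

definition crossing_edges :: "'a set set \<Rightarrow> 'a set set \<Rightarrow> 'a set set" where
  "crossing_edges E P =
     {e \<in> E. \<exists>u v S T. e = {u, v} \<and> S \<in> P \<and> T \<in> P \<and> S \<noteq> T \<and> u \<in> S \<and> v \<in> T}"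

definition partition_ratio :: "'a set set \<Rightarrow> 'a set set \<Rightarrow> real" where
  "partition_ratio E P = real (card (crossing_edges E P)) / (real (card P) - 1)"

text \<open>The partition value \<open>\<Phi>\<close>; meaningful for finite vertex sets with at least two elements.\<close>

definition partition_value :: "'a set \<Rightarrow> 'a set set \<Rightarrow> real" where
  "partition_value V E = Min (partition_ratio E ` {P. partition_on V P \<and> 2 \<le> card P})"

definition optimal_partition :: "'a set \<Rightarrow> 'a set set \<Rightarrow> 'a set set \<Rightarrow> bool" where
  "optimal_partition V E P \<longleftrightarrow>
     partition_on V P \<and> 2 \<le> card P \<and> partition_ratio E P = partition_value V E"

text \<open>\<open>ideal_loads E load S \<D>\<close> says that some run of the ideal-load recursion on the subgraph
  of \<open>E\<close> induced by \<open>S\<close> assigns the loads \<open>load\<close> to its edges. The minimizing partitions need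
  not be unique, so \<open>\<D>\<close> records the run: it is the set of all pairs \<open>(H, P)\<close> such that the
  subgraph induced by \<open>H\<close> arises and is split along the partition \<open>P\<close>. The values of \<open>load\<close> outside
  the edge set are unconstrained.\<close>

inductive ideal_loads ::
  "'a set set \<Rightarrow> ('a set \<Rightarrow> real) \<Rightarrow> 'a set \<Rightarrow> ('a set \<times> 'a set set) set \<Rightarrow> bool"
  for E load where
  single: "ideal_loads E load {v} {}"
| split: "ideal_loads E load S (insert (S, P) (\<Union>T\<in>P. \<D> T))"
  if "optimal_partition S (induced_edges E S) P"
    and "\<And>T. T \<in> P \<Longrightarrow> connected_graph T (induced_edges E T)"
    and "\<And>e. e \<in> crossing_edges (induced_edges E S) P \<Longrightarrow>
           load e = 1 / partition_value S (induced_edges E S)"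
    and "\<And>T. T \<in> P \<Longrightarrow> ideal_loads E load T (\<D> T)"

definition split_at ::
  "'a set set \<Rightarrow> ('a set \<Rightarrow> real) \<Rightarrow> ('a set \<times> 'a set set) set \<Rightarrow> real \<Rightarrow> 'a set \<Rightarrow> bool" where
  "split_at E load \<D> l S \<longleftrightarrow>
     (\<exists>P. (S, P) \<in> \<D> \<and> load ` crossing_edges (induced_edges E S) P = {l})"

text \<open>A minimizing partition need not be the finest one, so a part of a subgraph split at
  some load may be split again at the same load; the first split is the outermost one.\<close>

definition first_split_at ::
  "'a set set \<Rightarrow> ('a set \<Rightarrow> real) \<Rightarrow> ('a set \<times> 'a set set) set \<Rightarrow> real \<Rightarrow> 'a set \<Rightarrow> bool" where
  "first_split_at E load \<D> l S \<longleftrightarrow>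
     split_at E load \<D> l S \<and> \<not> (\<exists>S'. S \<subset> S' \<and> split_at E load \<D> l S')"

definition plateau :: "'a set set \<Rightarrow> ('a set \<Rightarrow> real) \<Rightarrow> (nat \<Rightarrow> real) \<Rightarrow> nat \<Rightarrow> 'a set set" where
  "plateau E load L i = {e \<in> E. load e = L i}"

definition plateau_chain ::
  "'a set \<Rightarrow> 'a set set \<Rightarrow> ('a set \<Rightarrow> real) \<Rightarrow> (nat \<Rightarrow> real) \<Rightarrow> nat \<Rightarrow> 'a set set" where
  "plateau_chain V E load L i =
     (if i = 0 then {V} else conn_components V (E - (\<Union>q\<in>{1..i}. plateau E load L q)))"

text \<open>That \<open>P i\<close> is obtained from \<open>P (i - 1)\<close> by deleting \<open>A i\<close> means: \<open>A i\<close> consists of edges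
  inside the parts of \<open>P (i - 1)\<close>, and the parts of \<open>P i\<close> are the connected components
  that remain when \<open>A i\<close> is removed from the subgraphs induced by these parts.\<close>

definition inner_edges :: "'a set set \<Rightarrow> 'a set set \<Rightarrow> 'a set set" where
  "inner_edges E P = (\<Union>S\<in>P. induced_edges E S)"

definition principal_sequence ::
  "'a set \<Rightarrow> 'a set set \<Rightarrow> nat \<Rightarrow> (nat \<Rightarrow> 'a set set) \<Rightarrow> (nat \<Rightarrow> 'a set set) \<Rightarrow> (nat \<Rightarrow> real) \<Rightarrow> bool"
where
  "principal_sequence V E t P A lam \<longleftrightarrow>
     P 0 = {V} \<and>
     (\<forall>i\<in>{1..t}. refines V (P i) (P (i - 1)) \<and> P i \<noteq> P (i - 1)) \<and>
     (\<forall>i\<in>{1..t}. 0 < lam i) \<and> strict_mono_on {1..t} lam \<and>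
     (\<forall>i\<in>{1..t}.
        A i \<subseteq> inner_edges E (P (i - 1)) \<and>
        P i = conn_components V (inner_edges E (P (i - 1)) - A i) \<and>
        real (card (A i)) = (real (card (P i)) - real (card (P (i - 1)))) * lam i)"

end

theory Submission
  imports Defs
begin

text \<open>Refining an optimal partition inside one of its parts \<open>T\<close> shows \<open>\<Phi>(T) \<ge> \<Phi>(S)\<close>, so the loads
  never increase along the recursion and every edge inside \<open>S\<close> has load at most \<open>1 / \<Phi>(S)\<close>. Hence, for
  a threshold \<open>l\<close> below this bound, the edges of load \<open>\<le> l\<close> (or \<open>< l\<close>) never leave the parts of \<open>S\<close>
  and their components can be counted part by part; at \<open>l = 1 / \<Phi>(S)\<close> all loads are \<open>\<le> l\<close> and \<open>S\<close> is a
  single component. Induction over the recursion then gives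
  \<open>l * #{load = l} = #components(load < l) - #components(load \<le> l)\<close>, regardless of which optimal
  partitions were chosen.\<close>

section \<open>Connected components\<close>

lemma sym_adj: "sym (adj F)"
  by (auto simp: adj_def sym_def insert_commute)

lemma adj_mono: "F \<subseteq> G \<Longrightarrow> adj F \<subseteq> adj G"
  by (auto simp: adj_def)

lemma equiv_reachable: "equiv V ((adj F)\<^sup>* \<inter> V \<times> V)"
  by (rule equivI)
     (auto simp: refl_on_def intro!: symI transI
       dest: symD[OF sym_rtrancl[OF sym_adj]] rtrancl_trans)

lemma partition_on_conn_components: "partition_on V (conn_components V F)"
  unfolding conn_components_def by (rule partition_on_quotient[OF equiv_reachable])

lemma conn_components_altdef:
  "conn_components V F = (\<lambda>v. (adj F)\<^sup>* `` {v} \<inter> V) ` V"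
  unfolding conn_components_def quotient_def by auto

lemma conn_components_connected:
  assumes "connected_graph V F"
  shows "conn_components V F = {V}"
proof -
  have "(adj F)\<^sup>* `` {v} \<inter> V = V" if "v \<in> V" for v
    using assms that by (auto simp: connected_graph_def)
  then show ?thesis
    using assms by (auto simp: conn_components_altdef connected_graph_def)
qed

lemma refines_conn_components:
  assumes "F \<subseteq> G"
  shows "refines V (conn_components V F) (conn_components V G)"
  unfolding refines_def
proof (intro conjI ballI partition_on_conn_components)
  fix X assume "X \<in> conn_components V F"
  then obtain v where v: "v \<in> V" "X = (adj F)\<^sup>* `` {v} \<inter> V"
    by (auto simp: conn_components_altdef)
  moreover have "(adj F)\<^sup>* `` {v} \<subseteq> (adj G)\<^sup>* `` {v}"
    using rtrancl_mono[OF adj_mono[OF assms]] by auto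
  ultimately show "\<exists>Y\<in>conn_components V G. X \<subseteq> Y"
    by (auto simp: conn_components_altdef)
qed

text \<open>Meant for a graph edge inside a component: its endpoints are joined by a path in
  \<open>F\<close> even when the edge itself is absent from \<open>F\<close>.\<close>

lemma conn_component_edge:
  assumes "X \<in> conn_components V F" "{u, v} \<subseteq> X"
  shows "(u, v) \<in> (adj F)\<^sup>*"
proof -
  obtain w where "(w, u) \<in> (adj F)\<^sup>*" "(w, v) \<in> (adj F)\<^sup>*"
    using assms by (auto simp: conn_components_altdef)
  then show ?thesis
    using symD[OF sym_rtrancl[OF sym_adj]] by (meson rtrancl_trans)
qed

text \<open>Each edge of a walk starting in \<open>T\<close> meets \<open>T\<close>, so by
  \<open>closed\<close> it lies in \<open>T\<close>. The walk never leaves \<open>T\<close> and uses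
  induced edges only.\<close>

lemma reachable_in_closed_part:
  assumes "(u, v) \<in> (adj F)\<^sup>*" "u \<in> T"
    and closed: "\<And>e. e \<in> F \<Longrightarrow> e \<inter> T \<noteq> {} \<Longrightarrow> e \<subseteq> T"
  shows "v \<in> T \<and> (u, v) \<in> (adj (induced_edges F T))\<^sup>*"
  using assms(1)
proof (induction rule: rtrancl_induct)
  case base
  then show ?case using assms(2) by simp
next
  case (step y z)
  then have "{y, z} \<in> F" "{y, z} \<subseteq> T"
    using closed[of "{y, z}"] by (auto simp: adj_def)
  then have "(y, z) \<in> adj (induced_edges F T)"
    by (auto simp: adj_def induced_edges_def)
  with step show ?case
    using \<open>{y, z} \<subseteq> T\<close> by (auto intro: rtrancl_into_rtrancl)
qed

lemma part_closed:
  assumes "partition_on S P" "T \<in> P" "e \<in> F" "e \<inter> T \<noteq> {}" "\<forall>e\<in>F. \<exists>T\<in>P. e \<subseteq> T"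
  shows "e \<subseteq> T"
proof -
  obtain U where U: "U \<in> P" "e \<subseteq> U" using assms by auto
  then have "U \<inter> T \<noteq> {}" using assms(4) by auto
  then have "U = T"
    using partition_onD2[OF assms(1)] U assms(2) by (auto simp: disjoint_def)
  with U show ?thesis by simp
qed

text \<open>With no edge of \<open>F\<close> between parts, the class of a vertex is the same
  whether computed in \<open>S\<close> or in its own part.\<close>

lemma conn_components_parts:
  assumes P: "partition_on S P" and F: "\<forall>e\<in>F. \<exists>T\<in>P. e \<subseteq> T"
  shows "conn_components S F = (\<Union>T\<in>P. conn_components T (induced_edges F T))"
proof -
  have eq: "(adj F)\<^sup>* `` {v} \<inter> S = (adj (induced_edges F T))\<^sup>* `` {v} \<inter> T"
    if "T \<in> P" "v \<in> T" for T v
  proof -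
    have "adj (induced_edges F T) \<subseteq> adj F"
      by (rule adj_mono) (auto simp: induced_edges_def)
    then have "(adj (induced_edges F T))\<^sup>* \<subseteq> (adj F)\<^sup>*" by (rule rtrancl_mono)
    moreover have "T \<subseteq> S" using P that by (auto simp: partition_on_def)
    moreover have "w \<in> T \<and> (v, w) \<in> (adj (induced_edges F T))\<^sup>*" if "(v, w) \<in> (adj F)\<^sup>*" for w
      using reachable_in_closed_part[OF that \<open>v \<in> T\<close>] part_closed[OF P \<open>T \<in> P\<close> _ _ F] by blast
    ultimately show ?thesis by auto
  qed
  have "conn_components S F = (\<Union>T\<in>P. (\<lambda>v. (adj F)\<^sup>* `` {v} \<inter> S) ` T)"
    using partition_onD1[OF P] by (auto simp: conn_components_altdef)
  also have "\<dots> = (\<Union>T\<in>P. conn_components T (induced_edges F T))"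
    unfolding conn_components_altdef by (intro SUP_cong image_cong refl eq) auto
  finally show ?thesis .
qed

lemma card_conn_components_parts:
  assumes "finite S" and P: "partition_on S P" and F: "\<forall>e\<in>F. \<exists>T\<in>P. e \<subseteq> T"
  shows "card (conn_components S F) = (\<Sum>T\<in>P. card (conn_components T (induced_edges F T)))"
  unfolding conn_components_parts[OF P F]
proof (rule card_UN_disjoint)
  show "finite P" using finite_elements[OF \<open>finite S\<close> P] .
  show "\<forall>T\<in>P. finite (conn_components T (induced_edges F T))"
  proof
    fix T assume "T \<in> P"
    then have "finite T" using P \<open>finite S\<close> by (auto simp: partition_on_def intro: finite_subset)
    then show "finite (conn_components T (induced_edges F T))"
      by (simp add: conn_components_altdef)
  qed
  show "\<forall>T\<in>P. \<forall>U\<in>P. T \<noteq> U \<longrightarrow>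
      conn_components T (induced_edges F T) \<inter> conn_components U (induced_edges F U) = {}"
  proof (intro ballI impI)
    fix T U assume "T \<in> P" "U \<in> P" "T \<noteq> U"
    then have "T \<inter> U = {}" using partition_onD2[OF P] by (auto simp: disjoint_def)
    moreover have "X \<subseteq> T" "X \<noteq> {}" if "X \<in> conn_components T (induced_edges F T)" for X
      using that partition_on_conn_components[of T "induced_edges F T"]
      by (auto simp: partition_on_def)
    moreover have "X \<subseteq> U" if "X \<in> conn_components U (induced_edges F U)" for X
      using that partition_on_conn_components[of U "induced_edges F U"]
      by (auto simp: partition_on_def)
    \<comment> \<open>A common component would lie in \<open>T \<inter> U = {}\<close>, but
      components are nonempty.\<close>
    ultimately have "X = {}" if "X \<in> conn_components T (induced_edges F T)"
      "X \<in> conn_components U (induced_edges F U)" for X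
      using that by (metis Int_greatest subset_empty)
    then show "conn_components T (induced_edges F T) \<inter> conn_components U (induced_edges F U) = {}"
      using \<open>\<And>X. X \<in> conn_components T (induced_edges F T) \<Longrightarrow> X \<noteq> {}\<close>
      by (intro equals0I) (metis IntE)
  qed
qed

section \<open>Crossing edges and the partition value\<close>

lemma finite_induced_edges: "finite S \<Longrightarrow> finite (induced_edges E S)"
  by (rule finite_subset[of _ "Pow S"]) (auto simp: induced_edges_def)

lemma crossing_edges_subset: "crossing_edges F P \<subseteq> F"
  by (auto simp: crossing_edges_def)

lemma crossing_edge_not_in_part:
  assumes P: "partition_on S P" and "e \<in> crossing_edges F P" "T \<in> P"
  shows "\<not> e \<subseteq> T"
proof
  assume "e \<subseteq> T"
  from assms(2) obtain u v A B where
    *: "e = {u, v}" "A \<in> P" "B \<in> P" "A \<noteq> B" "u \<in> A" "v \<in> B"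
    unfolding crossing_edges_def by blast
  then have "A \<inter> T \<noteq> {}" "B \<inter> T \<noteq> {}" using \<open>e \<subseteq> T\<close> by auto
  then have "A = T" "B = T"
    using partition_onD2[OF P] * \<open>T \<in> P\<close> unfolding disjoint_def by metis+
  then show False using * by simp
qed

text \<open>The case split by which an edge is followed down the recursion until it is cut.\<close>

lemma edge_cases:
  assumes P: "partition_on S P" and e: "e \<in> induced_edges E S" "card e = 2"
  obtains "e \<in> crossing_edges (induced_edges E S) P"
  | T where "T \<in> P" "e \<in> induced_edges E T"
proof -
  obtain u v where uv: "e = {u, v}" using e(2) by (auto simp: card_2_iff)
  have "u \<in> \<Union>P" "v \<in> \<Union>P" using e(1) partition_onD1[OF P] uv by (auto simp: induced_edges_def)
  then obtain A B where AB: "A \<in> P" "u \<in> A" "B \<in> P" "v \<in> B" by blast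
  show thesis
  proof (cases "A = B")
    case True
    then show ?thesis using that(2)[of A] AB e(1) uv by (auto simp: induced_edges_def)
  next
    case False
    then show ?thesis using that(1) AB e(1) uv unfolding crossing_edges_def by blast
  qed
qed

lemma edges_in_parts:
  assumes P: "partition_on S P" and E: "\<forall>e\<in>E. card e = 2"
    and F: "F \<subseteq> induced_edges E S" "F \<inter> crossing_edges (induced_edges E S) P = {}"
  shows "\<forall>e\<in>F. \<exists>T\<in>P. e \<subseteq> T"
proof
  fix e assume "e \<in> F"
  then have e: "e \<in> induced_edges E S" "card e = 2"
    using F(1) E by (auto simp: induced_edges_def)
  from P e show "\<exists>T\<in>P. e \<subseteq> T"
  proof (cases rule: edge_cases)
    case 1
    then show ?thesis using F(2) \<open>e \<in> F\<close> by auto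
  next
    case (2 T)
    then show ?thesis by (auto simp: induced_edges_def)
  qed
qed

text \<open>A path joins two different parts. If no edge crossed, each of its steps would stay in
  the part where it began.\<close>

lemma crossing_edges_nonempty:
  assumes conn: "connected_graph S F" and P: "partition_on S P" and "2 \<le> card P"
    and F: "\<forall>e\<in>F. e \<subseteq> S"
  shows "crossing_edges F P \<noteq> {}"
proof
  assume none: "crossing_edges F P = {}"
  \<comment> \<open>An infinite \<open>P\<close> is excluded since its \<open>card\<close> would be
    0.\<close>
  obtain T U where TU: "T \<in> P" "U \<in> P" "T \<noteq> U"
    using \<open>2 \<le> card P\<close> card_le_Suc0_iff_eq[of P] card.infinite[of P] by fastforce
  obtain u v where uv: "u \<in> T" "v \<in> U"
    using partition_onD3[OF P] TU by (metis all_not_in_conv)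
  then have "(u, v) \<in> (adj F)\<^sup>*"
    using conn TU partition_onD1[OF P] by (auto simp: connected_graph_def)
  then have "v \<in> T"
  proof (induction rule: rtrancl_induct)
    case base
    then show ?case by (rule uv(1))
  next
    case (step y z)
    then have yz: "{y, z} \<in> F" by (simp add: adj_def)
    then have "z \<in> \<Union>P" using F partition_onD1[OF P] by auto
    then obtain W where W: "W \<in> P" "z \<in> W" by auto
    have "W = T"
    proof (rule ccontr)
      assume "W \<noteq> T"
      then have "{y, z} \<in> crossing_edges F P"
        using yz W TU(1) step.IH unfolding crossing_edges_def by blast
      then show False using none by simp
    qed
    with W show ?case by simp
  qed
  then show False using partition_onD2[OF P] TU uv by (auto simp: disjoint_def)
qed

section \<open>Bounds on the partition value and its growth on parts\<close>

lemma partition_value_le: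
  assumes "finite S" "partition_on S Q" "2 \<le> card Q"
  shows "partition_value S F * (real (card Q) - 1) \<le> real (card (crossing_edges F Q))"
proof -
  have "partition_value S F \<le> partition_ratio F Q"
    unfolding partition_value_def
    using assms finitely_many_partition_on[of S] by (intro Min_le) auto
  then show ?thesis
    using assms(3) by (simp add: partition_ratio_def field_simps)
qed

lemma optimal_partition_card:
  assumes "optimal_partition S F P"
  shows "real (card (crossing_edges F P)) = partition_value S F * (real (card P) - 1)"
  using assms by (auto simp: optimal_partition_def partition_ratio_def field_simps)

text \<open>Connectivity forces a crossing edge of \<open>P\<close>, so the product of the partition
  value with \<open>card P - 1\<close> is positive.\<close>

lemma partition_value_pos:
  assumes "finite S" "connected_graph S (induced_edges E S)"
    and opt: "optimal_partition S (induced_edges E S) P"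
  shows "0 < partition_value S (induced_edges E S)"
proof -
  have "crossing_edges (induced_edges E S) P \<noteq> {}"
    using assms by (intro crossing_edges_nonempty[of S]) (auto simp: optimal_partition_def induced_edges_def)
  moreover have "finite (crossing_edges (induced_edges E S) P)"
    using finite_induced_edges[OF \<open>finite S\<close>, of E] by (simp add: crossing_edges_def)
  ultimately have "0 < partition_value S (induced_edges E S) * (real (card P) - 1)"
    by (simp add: optimal_partition_card[OF opt, symmetric] card_gt_0_iff)
  moreover have "0 < real (card P) - 1" using opt by (auto simp: optimal_partition_def)
  ultimately show ?thesis by (simp add: zero_less_mult_iff)
qed

lemma partition_on_refine_part:
  assumes P: "partition_on S P" and T: "T \<in> P" and Q: "partition_on T Q"
  shows "partition_on S (P - {T} \<union> Q)" "(P - {T}) \<inter> Q = {}"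
proof -
  have dis: "A \<inter> B = {}" if "A \<in> P - {T}" "B \<in> Q" for A B
  proof -
    have "A \<inter> T = {}" using that partition_onD2[OF P] T by (auto simp: disjoint_def)
    moreover have "B \<subseteq> T" using that partition_onD1[OF Q] by auto
    ultimately show ?thesis by auto
  qed
  have ne: "{} \<notin> Q" "{} \<notin> P" using P Q by (auto simp: partition_on_def)
  show "(P - {T}) \<inter> Q = {}"
  proof (intro equals0I)
    fix A assume "A \<in> (P - {T}) \<inter> Q"
    then show False using dis[of A A] ne by auto
  qed
  show "partition_on S (P - {T} \<union> Q)"
  proof (rule partition_onI)
    show "\<Union>(P - {T} \<union> Q) = S"
      using partition_onD1[OF P] partition_onD1[OF Q] T by auto
    show "disjnt A B" if AB: "A \<in> P - {T} \<union> Q" "B \<in> P - {T} \<union> Q" "A \<noteq> B" for A B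
    proof -
      consider "A \<in> P" "B \<in> P" | "A \<in> P - {T}" "B \<in> Q" | "A \<in> Q" "B \<in> P - {T}" | "A \<in> Q" "B \<in> Q"
        using AB(1,2) by blast
      then show ?thesis
      proof cases
        case 1
        then show ?thesis using disjointD[OF partition_onD2[OF P]] AB(3) by (simp add: disjnt_def)
      next
        case 2
        then show ?thesis using dis by (simp add: disjnt_def)
      next
        case 3
        then show ?thesis using dis[of B A] by (simp add: disjnt_def Int_commute)
      next
        case 4
        then show ?thesis using disjointD[OF partition_onD2[OF Q]] AB(3) by (simp add: disjnt_def)
      qed
    qed
    show "{} \<notin> P - {T} \<union> Q" using ne by auto
  qed
qed

text \<open>Replacing \<open>T\<close> by the parts of \<open>Q\<close> gives a partition
  \<open>R\<close> of \<open>S\<close> with |P| + |Q| - 1 parts, crossed by at most the edges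
  crossing \<open>P\<close> plus the edges inside \<open>T\<close> crossing \<open>Q\<close>. Hence
  \<phi> (|P| + |Q| - 2) \<le> |E(S/R)| \<le> \<phi> (|P| - 1) + |E(T/Q)|, and \<phi> (|P| - 1)
  cancels.\<close>

lemma partition_value_part_ge:
  assumes fin: "finite S" and opt: "optimal_partition S (induced_edges E S) P"
    and T: "T \<in> P" "2 \<le> card T"
  shows "partition_value S (induced_edges E S) \<le> partition_value T (induced_edges E T)"
proof -
  define \<phi> where "\<phi> = partition_value S (induced_edges E S)"
  have P: "partition_on S P" "2 \<le> card P" using opt by (auto simp: optimal_partition_def)
  have "T \<subseteq> S" using P T by (auto simp: partition_on_def)
  then have finT: "finite T" using fin finite_subset by blast
  have finP: "finite P" using finite_elements[OF fin P(1)] .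
  have "\<phi> \<le> partition_ratio (induced_edges E T) Q" if Q: "partition_on T Q" "2 \<le> card Q" for Q
  proof -
    let ?R = "P - {T} \<union> Q"
    have finQ: "finite Q" using finite_elements[OF finT Q(1)] .
    note R = partition_on_refine_part[OF P(1) T(1) Q(1)]
    have "card ?R = card (P - {T}) + card Q"
      using finP finQ R(2) by (intro card_Un_disjoint) auto
    then have cR: "card ?R + 1 = card P + card Q"
      using T(1) finP P(2) by simp
    have "crossing_edges (induced_edges E S) ?R
      \<subseteq> crossing_edges (induced_edges E S) P \<union> crossing_edges (induced_edges E T) Q"
    proof
      fix e assume "e \<in> crossing_edges (induced_edges E S) ?R"
      then obtain u v A B where e: "e \<in> induced_edges E S" "e = {u, v}"
        "A \<in> ?R" "B \<in> ?R" "A \<noteq> B" "u \<in> A" "v \<in> B"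
        unfolding crossing_edges_def by blast
      have sub: "C \<subseteq> T" if "C \<in> Q" for C using that Q(1) by (auto simp: partition_on_def)
      show "e \<in> crossing_edges (induced_edges E S) P \<union> crossing_edges (induced_edges E T) Q"
      proof (cases "A \<in> Q \<and> B \<in> Q")
        case True
        then have "e \<in> induced_edges E T" using e sub by (auto simp: induced_edges_def)
        then show ?thesis using e True unfolding crossing_edges_def by blast
      next
        case False
        \<comment> \<open>Pieces of \<open>T\<close> are merged back into \<open>T\<close>. At most
          one of \<open>A\<close>, \<open>B\<close> is such a piece, so the merged parts stay
          distinct and the edge crosses \<open>P\<close>.\<close>
        define A' where "A' = (if A \<in> Q then T else A)"
        define B' where "B' = (if B \<in> Q then T else B)"
        have "A' \<in> P" "B' \<in> P" "A' \<noteq> B'" "u \<in> A'" "v \<in> B'"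
          using e False sub T(1) by (auto simp: A'_def B'_def)
        then show ?thesis using e unfolding crossing_edges_def by blast
      qed
    qed
    then have "card (crossing_edges (induced_edges E S) ?R)
      \<le> card (crossing_edges (induced_edges E S) P \<union> crossing_edges (induced_edges E T) Q)"
      using finite_induced_edges[OF fin, of E] finite_induced_edges[OF finT, of E]
      by (intro card_mono) (auto simp: crossing_edges_def)
    also have "\<dots> \<le> card (crossing_edges (induced_edges E S) P) + card (crossing_edges (induced_edges E T) Q)"
      by (rule card_Un_le)
    finally have "real (card (crossing_edges (induced_edges E S) ?R))
      \<le> \<phi> * (real (card P) - 1) + real (card (crossing_edges (induced_edges E T) Q))"
      using optimal_partition_card[OF opt] unfolding \<phi>_def by linarith
    moreover have "\<phi> * (real (card ?R) - 1) \<le> real (card (crossing_edges (induced_edges E S) ?R))"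
      unfolding \<phi>_def using cR P(2) Q(2) by (intro partition_value_le fin R) simp
    moreover have "real (card ?R) = real (card P) + real (card Q) - 1"
      using cR by linarith
    ultimately have "\<phi> * (real (card Q) - 1) \<le> real (card (crossing_edges (induced_edges E T) Q))"
      by (simp add: algebra_simps)
    then show ?thesis
      using Q(2) by (simp add: partition_ratio_def field_simps)
  qed
  \<comment> \<open>The partition into singletons shows that the minimum for \<open>T\<close> is
    over a nonempty family.\<close>
  moreover have "(\<lambda>x. {x}) ` T \<in> {Q. partition_on T Q \<and> 2 \<le> card Q}"
    using T(2) by (auto simp: card_image partition_on_def disjoint_def)
  ultimately show ?thesis
    unfolding \<phi>_def[symmetric] partition_value_def[of T]
    using finitely_many_partition_on[OF finT] by (subst Min_ge_iff) auto
qed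

section \<open>The ideal-load recursion\<close>

text \<open>An edge cut at \<open>S\<close> attains the upper bound. Any other edge lies in a part
  \<open>T\<close>, where the bound from the induction is at most that of \<open>S\<close> by
  \<open>partition_value_part_ge\<close>.\<close>

lemma ideal_loads_bounds:
  assumes "ideal_loads E load S \<D>" and E: "\<forall>e\<in>E. card e = 2"
    and "finite S" "connected_graph S (induced_edges E S)" "e \<in> induced_edges E S"
  shows "0 < load e \<and> load e \<le> 1 / partition_value S (induced_edges E S)"
  using assms(1,3-)
proof (induction rule: ideal_loads.induct)
  case (single v)
  then have "e \<subseteq> {v}" "card e = 2" using E by (auto simp: induced_edges_def)
  then show ?case using card_mono[of "{v}" e] by simp
next
  case (split S P \<D>)
  have P: "partition_on S P" using split.hyps by (simp add: optimal_partition_def)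
  have pos: "0 < partition_value S (induced_edges E S)"
    using split.prems split.hyps(1) by (intro partition_value_pos)
  have "card e = 2" using split.prems E by (auto simp: induced_edges_def)
  with P split.prems(3) show ?case
  proof (cases rule: edge_cases)
    case 1
    then show ?thesis using split.hyps(3)[OF 1] pos by simp
  next
    case (2 T)
    have "T \<subseteq> S" using P 2 by (auto simp: partition_on_def)
    then have finT: "finite T" using split.prems(1) finite_subset by blast
    have "0 < load e \<and> load e \<le> 1 / partition_value T (induced_edges E T)"
      using split.IH[OF 2(1) finT split.hyps(2)[OF 2(1)] 2(2)] .
    \<comment> \<open>The edge \<open>e\<close> itself supplies two vertices of
      \<open>T\<close>.\<close>
    moreover have "2 \<le> card T"
      using card_mono[OF finT, of e] 2 \<open>card e = 2\<close> by (auto simp: induced_edges_def)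
    then have "partition_value S (induced_edges E S) \<le> partition_value T (induced_edges E T)"
      using split.prems(1) split.hyps(1) 2(1) by (intro partition_value_part_ge)
    then have "1 / partition_value T (induced_edges E T) \<le> 1 / partition_value S (induced_edges E S)"
      using pos by (intro divide_left_mono) auto
    ultimately show ?thesis by linarith
  qed
qed

text \<open>All along the descent to the split that cuts \<open>{u, v}\<close>, the edges lighter
  than \<open>l\<close> stay inside parts, and that split puts \<open>u\<close> and \<open>v\<close>
  into different parts. Consequently the components of the light subgraph contain only light
  edges.\<close>

lemma heavy_edge_separated:
  assumes "ideal_loads E load S \<D>" and E: "\<forall>e\<in>E. card e = 2"
    and "finite S" "connected_graph S (induced_edges E S)"
    and "{u, v} \<in> induced_edges E S" "l \<le> load {u, v}"
  shows "(u, v) \<notin> (adj {e \<in> induced_edges E S. load e < l})\<^sup>*"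
  using assms(1,3-)
proof (induction rule: ideal_loads.induct)
  case (single w)
  then have "{u, v} \<subseteq> {w}" "card {u, v} = 2" using E by (auto simp: induced_edges_def)
  then show ?case using card_mono[of "{w}" "{u, v}"] by simp
next
  case (split S P \<D>)
  let ?F = "\<lambda>S. {e \<in> induced_edges E S. load e < l}"
  have P: "partition_on S P" using split.hyps by (simp add: optimal_partition_def)
  have bound: "load {u, v} \<le> 1 / partition_value S (induced_edges E S)"
    using ideal_loads_bounds[OF ideal_loads.split[OF split.hyps(1-4)] E split.prems(1-3)]
    by simp
  \<comment> \<open>Crossing edges have load
    \<open>1 / partition_value S (induced_edges E S)\<close>, which is at least
    \<open>load {u, v}\<close> and hence at least \<open>l\<close>; so none lies in
    \<open>?F S\<close>.\<close>
  have parts: "\<forall>e\<in>?F S. \<exists>T\<in>P. e \<subseteq> T"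
    using split.hyps(3) bound split.prems(4) by (intro edges_in_parts[OF P E]) fastforce+
  have closed: "e \<subseteq> T" if "T \<in> P" "e \<in> ?F S" "e \<inter> T \<noteq> {}" for e T
    using part_closed[OF P that parts] .
  have "card {u, v} = 2" using split.prems E by (auto simp: induced_edges_def)
  with P split.prems(3) show ?case
  proof (cases rule: edge_cases)
    case 1
    show ?thesis
    proof
      assume uv: "(u, v) \<in> (adj (?F S))\<^sup>*"
      have "u \<in> \<Union>P" using split.prems(3) partition_onD1[OF P] by (auto simp: induced_edges_def)
      then obtain T where T: "T \<in> P" "u \<in> T" by auto
      with reachable_in_closed_part[OF uv T(2) closed[OF T(1)]] have "{u, v} \<subseteq> T" by auto
      then show False using crossing_edge_not_in_part[OF P 1 T(1)] by simp
    qed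
  next
    case (2 T)
    have "T \<subseteq> S" using P 2 by (auto simp: partition_on_def)
    then have finT: "finite T" using split.prems(1) finite_subset by blast
    have "(u, v) \<notin> (adj (?F T))\<^sup>*"
      using split.IH[OF 2(1) finT split.hyps(2)[OF 2(1)] 2(2) split.prems(4)] .
    moreover have "induced_edges (?F S) T = ?F T"
      using \<open>T \<subseteq> S\<close> by (auto simp: induced_edges_def)
    moreover have "u \<in> T" using 2 by (auto simp: induced_edges_def)
    ultimately show ?thesis
      using reachable_in_closed_part[of u v "?F S" T] closed[OF 2(1)] by metis
  qed
qed

text \<open>The identity is claimed for every real \<open>l\<close>, attained or not, so that the
  induction can use the same \<open>l\<close> in all parts. If no edge has load \<open>l\<close>,
  both sides vanish.\<close>

lemma card_plateau:
  assumes "ideal_loads E load S \<D>" and E: "\<forall>e\<in>E. card e = 2"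
    and "finite S" "connected_graph S (induced_edges E S)"
  shows "real (card {e \<in> induced_edges E S. load e = l}) * l =
    real (card (conn_components S {e \<in> induced_edges E S. load e < l})) -
    real (card (conn_components S {e \<in> induced_edges E S. load e \<le> l}))"
  using assms(1,3-)
proof (induction rule: ideal_loads.induct)
  case (single v)
  have "induced_edges E {v} = {}"
  proof -
    have False if "e \<in> induced_edges E {v}" for e
      using that E card_mono[of "{v}" e] by (auto simp: induced_edges_def)
    then show ?thesis by auto
  qed
  then show ?case by simp
next
  case (split S P \<D>)
  define \<phi> where "\<phi> = partition_value S (induced_edges E S)"
  let ?lt = "\<lambda>S. {e \<in> induced_edges E S. load e < l}"
  let ?le = "\<lambda>S. {e \<in> induced_edges E S. load e \<le> l}"
  let ?eq = "\<lambda>S. {e \<in> induced_edges E S. load e = l}"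
  let ?X = "crossing_edges (induced_edges E S) P"
  have P: "partition_on S P" "2 \<le> card P"
    using split.hyps by (simp_all add: optimal_partition_def)
  have finP: "finite P" using finite_elements[OF split.prems(1) P(1)] .
  have sub: "T \<subseteq> S" if "T \<in> P" for T using P that by (auto simp: partition_on_def)
  have finT: "finite T" if "T \<in> P" for T
    using sub[OF that] split.prems(1) finite_subset by blast
  have pos: "0 < \<phi>"
    unfolding \<phi>_def using split.prems split.hyps(1) by (intro partition_value_pos)
  have bound: "load e \<le> 1 / \<phi>" if "e \<in> induced_edges E S" for e
    using ideal_loads_bounds[OF ideal_loads.split[OF split.hyps(1-4)] E split.prems(1-2) that]
    by (simp add: \<phi>_def)
  have IH: "real (card (?eq T)) * l =
      real (card (conn_components T (?lt T))) - real (card (conn_components T (?le T)))"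
    if "T \<in> P" for T
    using split.IH[OF that finT[OF that] split.hyps(2)[OF that]] .
  have loadX: "load e = 1 / \<phi>" if "e \<in> ?X" for e
    using split.hyps(3)[OF that] by (simp add: \<phi>_def)
  have one: "card (conn_components S (?le S)) = 1" if "1 / \<phi> \<le> l"
  proof -
    have "?le S = induced_edges E S" using bound that by fastforce
    then show ?thesis using conn_components_connected[OF split.prems(2)] by simp
  qed
  \<comment> \<open>Equality \<open>l = 1 / \<phi>\<close> is allowed, because \<open>?lt\<close> is
    strict and still omits the crossing edges.\<close>
  have count: "card (conn_components S (?lt S)) = (\<Sum>T\<in>P. card (conn_components T (?lt T)))"
    if "l \<le> 1 / \<phi>"
  proof -
    have "induced_edges (?lt S) T = ?lt T" if "T \<in> P" for T
      using sub[OF that] by (auto simp: induced_edges_def)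
    moreover have "\<forall>e\<in>?lt S. \<exists>T\<in>P. e \<subseteq> T"
      using that loadX by (intro edges_in_parts[OF P(1) E]) fastforce+
    ultimately show ?thesis
      using card_conn_components_parts[OF split.prems(1) P(1)] by simp
  qed
  have eq_parts: "?eq S - ?X = (\<Union>T\<in>P. ?eq T)"
  proof (intro equalityI subsetI)
    fix e assume e: "e \<in> ?eq S - ?X"
    then have "e \<in> induced_edges E S" "card e = 2" using E by (auto simp: induced_edges_def)
    with P(1) show "e \<in> (\<Union>T\<in>P. ?eq T)"
      by (cases rule: edge_cases) (use e in auto)
  next
    fix e assume "e \<in> (\<Union>T\<in>P. ?eq T)"
    then obtain T where T: "T \<in> P" "e \<in> ?eq T" by auto
    then have "e \<in> ?eq S" using sub[OF T(1)] by (auto simp: induced_edges_def)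
    moreover have "e \<notin> ?X"
      using crossing_edge_not_in_part[OF P(1) _ T(1)] T(2) by (auto simp: induced_edges_def)
    ultimately show "e \<in> ?eq S - ?X" by simp
  qed
  have "card (\<Union>T\<in>P. ?eq T) = (\<Sum>T\<in>P. card (?eq T))"
  proof (rule card_UN_disjoint[OF finP])
    show "\<forall>T\<in>P. finite (?eq T)" by (simp add: finT finite_induced_edges)
    show "\<forall>T\<in>P. \<forall>U\<in>P. T \<noteq> U \<longrightarrow> ?eq T \<inter> ?eq U = {}"
    proof (intro ballI impI)
      fix T U assume "T \<in> P" "U \<in> P" "T \<noteq> U"
      then have "T \<inter> U = {}" using partition_onD2[OF P(1)] by (auto simp: disjoint_def)
      \<comment> \<open>An empty edge would be induced by both of the disjoint parts.\<close>
      moreover have "{} \<notin> E" using E by force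
      moreover have "e \<subseteq> T \<inter> U" if "e \<in> ?eq T \<inter> ?eq U" for e
        using that by (auto simp: induced_edges_def)
      ultimately show "?eq T \<inter> ?eq U = {}"
        unfolding induced_edges_def by fastforce
    qed
  qed
  then have sum_eq: "real (card (?eq S - ?X)) * l =
      (\<Sum>T\<in>P. real (card (conn_components T (?lt T))) - real (card (conn_components T (?le T))))"
    unfolding eq_parts by (simp add: sum_distrib_right IH)
  consider "l < 1 / \<phi>" | "l = 1 / \<phi>" | "1 / \<phi> < l" by linarith
  then show ?case
  proof cases
    case 1
    \<comment> \<open>Below \<open>1 / \<phi>\<close> no crossing edge takes part in any of the
      three sets, so the identity for \<open>S\<close> is the sum of those for the parts.\<close>
    have "induced_edges (?le S) T = ?le T" if "T \<in> P" for T
      using sub[OF that] by (auto simp: induced_edges_def)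
    moreover have "\<forall>e\<in>?le S. \<exists>T\<in>P. e \<subseteq> T"
      using 1 loadX by (intro edges_in_parts[OF P(1) E]) fastforce+
    ultimately have "card (conn_components S (?le S)) = (\<Sum>T\<in>P. card (conn_components T (?le T)))"
      using card_conn_components_parts[OF split.prems(1) P(1)] by simp
    moreover have "?eq S - ?X = ?eq S" using 1 loadX by fastforce
    ultimately show ?thesis using sum_eq count 1 by (simp add: sum_subtractf)
  next
    case 2
    \<comment> \<open>At \<open>l = 1 / \<phi>\<close> each part is one component of its
      \<open>?le\<close> graph, so the parts contribute the \<open>?lt\<close> count minus |P|. The
      crossing edges add |P| - 1 by optimality, leaving the \<open>?lt\<close> count minus the
      single component of \<open>?le S\<close>.\<close>
    have "card (conn_components T (?le T)) = 1" if "T \<in> P" for T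
    proof -
      have "?le T = induced_edges E T"
        using bound 2 sub[OF that] by (fastforce simp: induced_edges_def)
      then show ?thesis using conn_components_connected[OF split.hyps(2)[OF that]] by simp
    qed
    then have "real (card (?eq S - ?X)) * l = real (card (conn_components S (?lt S))) - real (card P)"
      using sum_eq count 2 by (simp add: sum_subtractf)
    moreover have "real (card (?eq S)) = real (card (?eq S - ?X)) + real (card ?X)"
    proof -
      have "?X \<subseteq> ?eq S" using loadX 2 crossing_edges_subset by fastforce
      moreover have "finite (?eq S)" using finite_induced_edges[OF split.prems(1)] by simp
      ultimately show ?thesis
        using card_Diff_subset[of ?X "?eq S"] card_mono[of "?eq S" ?X] finite_subset[of ?X "?eq S"]
        by simp
    qed
    moreover have "real (card ?X) * l = real (card P) - 1"
      using optimal_partition_card[OF split.hyps(1)] pos 2 by (simp add: \<phi>_def[symmetric])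
    ultimately show ?thesis using one 2 by (simp add: algebra_simps)
  next
    case 3
    \<comment> \<open>Above \<open>1 / \<phi>\<close> both subgraphs are the whole connected graph
      on \<open>S\<close>, and no edge has load \<open>l\<close>.\<close>
    then have "?eq S = {}" "?lt S = induced_edges E S" using bound by fastforce+
    then have "card (?eq S) = 0" "?lt S = induced_edges E S" by (simp_all only: card.empty)
    moreover have "card (conn_components S (induced_edges E S)) = 1"
      using conn_components_connected[OF split.prems(2)] by simp
    ultimately show ?thesis using one 3 by simp
  qed
qed

section \<open>Splits recorded in a run\<close>

lemma ideal_loads_crossing:
  assumes "ideal_loads E load S \<D>" "(H, P) \<in> \<D>"
  shows "H \<subseteq> S \<and> (\<forall>e\<in>crossing_edges (induced_edges E H) P.
    load e = 1 / partition_value H (induced_edges E H))"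
  using assms
proof (induction rule: ideal_loads.induct)
  case (split S Q \<D>)
  have "T \<subseteq> S" if "T \<in> Q" for T
    using split.hyps(1) that by (auto simp: optimal_partition_def partition_on_def)
  then show ?case using split.IH split.hyps(3) split.prems by blast
qed simp

text \<open>The recursion ends only at single vertices, which carry no edge, so every edge is cut on
  the way.\<close>

lemma ideal_loads_edge_split:
  assumes "ideal_loads E load S \<D>" and E: "\<forall>e\<in>E. card e = 2" and "e \<in> induced_edges E S"
  shows "\<exists>H P. (H, P) \<in> \<D> \<and> e \<in> crossing_edges (induced_edges E H) P"
  using assms(1,3)
proof (induction rule: ideal_loads.induct)
  case (single v)
  then have "e \<subseteq> {v}" "card e = 2" using E by (auto simp: induced_edges_def)
  then show ?case using card_mono[of "{v}" e] by simp
next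
  case (split S P \<D>)
  have P: "partition_on S P" using split.hyps by (simp add: optimal_partition_def)
  have "card e = 2" using split.prems E by (auto simp: induced_edges_def)
  with P split.prems show ?case
  proof (cases rule: edge_cases)
    case 1
    then show ?thesis by blast
  next
    case (2 T)
    then obtain H Q where "(H, Q) \<in> \<D> T" "e \<in> crossing_edges (induced_edges E H) Q"
      using split.IH[OF 2] by auto
    then show ?thesis using 2(1) by (intro exI[of _ H] exI[of _ Q]) auto
  qed
qed

lemma split_at_value:
  assumes "ideal_loads E load V \<D>" "split_at E load \<D> l S"
  shows "S \<subseteq> V" "1 / l = partition_value S (induced_edges E S)"
proof -
  obtain P where P: "(S, P) \<in> \<D>" "load ` crossing_edges (induced_edges E S) P = {l}"
    using assms(2) by (auto simp: split_at_def)
  note * = ideal_loads_crossing[OF assms(1) P(1)]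
  then show "S \<subseteq> V" by simp
  have "l \<in> load ` crossing_edges (induced_edges E S) P" using P(2) by simp
  then show "1 / l = partition_value S (induced_edges E S)" using * by auto
qed

text \<open>The split cutting \<open>e\<close> happens at \<open>load e\<close>. The sets split at
  that load are subsets of the finite \<open>V\<close>, so an inclusion-maximal one exists, and it
  is an outermost split.\<close>

lemma first_split_exists:
  assumes run: "ideal_loads E load V \<D>" and E: "\<forall>e\<in>E. card e = 2"
    and "finite V" "e \<in> induced_edges E V"
  shows "\<exists>S. first_split_at E load \<D> (load e) S"
proof -
  obtain H P where HP: "(H, P) \<in> \<D>" "e \<in> crossing_edges (induced_edges E H) P"
    using ideal_loads_edge_split[OF run E assms(4)] by blast
  then have "load ` crossing_edges (induced_edges E H) P = {load e}"
    using ideal_loads_crossing[OF run HP(1)] by auto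
  then have H: "H \<in> {S. split_at E load \<D> (load e) S}"
    using HP(1) by (auto simp: split_at_def)
  moreover have "finite {S. split_at E load \<D> (load e) S}"
    using split_at_value(1)[OF run] \<open>finite V\<close> by (auto intro: finite_subset[of _ "Pow V"])
  ultimately obtain M where "M \<in> {S. split_at E load \<D> (load e) S}"
    "\<forall>S\<in>{S. split_at E load \<D> (load e) S}. M \<subseteq> S \<longrightarrow> M = S"
    using finite_has_maximal[of "{S. split_at E load \<D> (load e) S}"] by blast
  then show ?thesis by (auto simp: first_split_at_def)
qed

section \<open>The plateau chain\<close>

theorem theorem3p1:
  fixes V :: "'a set" and E :: "'a set set" and load :: "'a set \<Rightarrow> real"
    and \<D> :: "('a set \<times> 'a set set) set" and L :: "nat \<Rightarrow> real" and t :: nat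
  assumes "simple_graph V E" and "connected_graph V E"
    and "ideal_loads E load V \<D>"
    and "strict_antimono_on {1..t} L" and "L ` {1..t} = load ` E"
  shows "principal_sequence V E t (plateau_chain V E load L) (plateau E load L) (\<lambda>i. 1 / L i)
    \<and> (\<forall>i\<in>{1..t}. real (card (plateau E load L i)) =
          (real (card (plateau_chain V E load L i)) - real (card (plateau_chain V E load L (i - 1))))
            * (1 / L i))
    \<and> (\<forall>i\<in>{1..t}. (\<exists>S. first_split_at E load \<D> (L i) S)
          \<and> (\<forall>S. split_at E load \<D> (L i) S \<longrightarrow>
               1 / L i = partition_value S (induced_edges E S)))"
proof -
  have fin: "finite V" and E: "\<forall>e\<in>E. card e = 2" and EV: "\<forall>e\<in>E. e \<subseteq> V"
    using assms(1) by (auto simp: simple_graph_def)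
  have ind: "induced_edges E V = E" using EV by (auto simp: induced_edges_def)
  have conn: "connected_graph V (induced_edges E V)" using assms(2) by (simp add: ind)
  have "finite E" using finite_induced_edges[OF fin, of E] by (simp add: ind)
  have L_less: "L j < L i" if "i \<in> {1..t}" "j \<in> {1..t}" "i < j" for i j
    using assms(4) that by (auto simp: monotone_on_def)
  have L_edge: "\<exists>e\<in>E. load e = L i" if "i \<in> {1..t}" for i
  proof -
    have "L i \<in> load ` E" using that unfolding assms(5)[symmetric] by simp
    then show ?thesis by auto
  qed
  have load_L: "\<exists>j\<in>{1..t}. load e = L j" if "e \<in> E" for e
  proof -
    have "load e \<in> L ` {1..t}" using that unfolding assms(5) by simp
    then show ?thesis by auto
  qed
  have L_pos: "0 < L i" if "i \<in> {1..t}" for i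
    using L_edge[OF that] ideal_loads_bounds[OF assms(3) E fin conn, unfolded ind] by metis
  define F where "F i = E - (\<Union>q\<in>{1..i}. plateau E load L q)" for i
  define C where "C = plateau_chain V E load L"
  define A where "A = plateau E load L"
  \<comment> \<open>The separate clause for index 0 in \<open>plateau_chain\<close> fits the general
    one: \<open>F 0 = E\<close>, and the graph is connected.\<close>
  have C: "C i = conn_components V (F i)" for i
    using conn_components_connected[OF assms(2)] by (simp add: C_def plateau_chain_def F_def)
  \<comment> \<open>Every load is some \<open>L j\<close> and \<open>L\<close> decreases, so
    removing the first \<open>i\<close> plateaus leaves exactly the edges with
    \<open>j > i\<close>.\<close>
  have F_lt: "F i = {e \<in> E. load e < L i}" if i: "i \<in> {1..t}" for i
  proof (intro equalityI subsetI)
    fix e assume e: "e \<in> F i"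
    then have "e \<in> E" by (simp add: F_def)
    then obtain j where j: "j \<in> {1..t}" "load e = L j" using load_L by blast
    then have "i < j" using e by (auto simp: F_def plateau_def not_le[symmetric])
    then show "e \<in> {e \<in> E. load e < L i}" using L_less[OF i j(1)] j(2) \<open>e \<in> E\<close> by simp
  next
    fix e assume e: "e \<in> {e \<in> E. load e < L i}"
    have "load e \<noteq> L q" if "q \<in> {1..i}" for q
      using L_less[of q i] i that e by (cases "q = i") auto
    then show "e \<in> F i" using e by (simp add: F_def plateau_def)
  qed
  have F_step: "F i = F (i - 1) - A i" if "i \<in> {1..t}" for i
  proof -
    have "{1..i} = insert i {1..i - 1}" using that by auto
    then show ?thesis by (auto simp: F_def A_def)
  qed
  \<comment> \<open>Bounding by \<open>L i\<close> instead of \<open>L (i - 1)\<close> covers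
    \<open>i = 1\<close>, where \<open>L 0\<close> is arbitrary, and gives both counts in
    \<open>card_plateau\<close> the same threshold.\<close>
  have F_le: "F (i - 1) = {e \<in> E. load e \<le> L i}" if i: "i \<in> {1..t}" for i
  proof -
    have "A i \<subseteq> F (i - 1)"
    proof
      fix e assume e: "e \<in> A i"
      have "load e \<noteq> L q" if "q \<in> {1..i - 1}" for q
      proof -
        have "q \<in> {1..t}" "q < i" using i that by auto
        then have "L i < L q" by (intro L_less i)
        then show ?thesis using e by (simp add: A_def plateau_def)
      qed
      then show "e \<in> F (i - 1)" using e by (simp add: F_def A_def plateau_def)
    qed
    then have "F (i - 1) = F i \<union> A i" unfolding F_step[OF i] by blast
    also have "\<dots> = {e \<in> E. load e \<le> L i}"
      unfolding F_lt[OF i] by (auto simp: A_def plateau_def)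
    finally show ?thesis .
  qed
  have A_F: "A i \<subseteq> F (i - 1)" if "i \<in> {1..t}" for i
    unfolding F_le[OF that] by (auto simp: A_def plateau_def)
  \<comment> \<open>An edge inside a component of \<open>F i\<close> could in principle have been
    deleted. For \<open>i > 0\<close>, \<open>heavy_edge_separated\<close> rules this out, since
    deleted edges have load at least \<open>L i\<close>; for \<open>i = 0\<close> nothing is
    deleted.\<close>
  have inner: "inner_edges E (C i) = F i" if i: "i \<le> t" for i
  proof (intro equalityI subsetI)
    fix e assume "e \<in> inner_edges E (C i)"
    then obtain X where X: "X \<in> conn_components V (F i)" "e \<in> E" "e \<subseteq> X"
      by (auto simp: inner_edges_def induced_edges_def C)
    then obtain u v where uv: "e = {u, v}" using E by (metis card_2_iff)
    then have reach: "(u, v) \<in> (adj (F i))\<^sup>*" using conn_component_edge X by metis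
    show "e \<in> F i"
    proof (cases "i = 0")
      case True
      then show ?thesis using X by (simp add: F_def)
    next
      case False
      then have i': "i \<in> {1..t}" using i by simp
      have "\<not> L i \<le> load e"
        using heavy_edge_separated[OF assms(3) E fin conn, of u v "L i"] reach uv X(2) F_lt[OF i']
        by (auto simp: ind)
      then show ?thesis using F_lt[OF i'] X(2) by auto
    qed
  next
    fix e assume e: "e \<in> F i"
    then have "e \<in> E" by (simp add: F_def)
    then obtain u v where uv: "e = {u, v}" using E by (metis card_2_iff)
    have "u \<in> V" "v \<in> V" using EV \<open>e \<in> E\<close> uv by auto
    moreover have "(u, v) \<in> (adj (F i))\<^sup>*" using e uv by (auto simp: adj_def)
    ultimately have "(adj (F i))\<^sup>* `` {u} \<inter> V \<in> C i" "e \<subseteq> (adj (F i))\<^sup>* `` {u} \<inter> V"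
      using uv by (auto simp: C conn_components_altdef)
    then show "e \<in> inner_edges E (C i)"
      using \<open>e \<in> E\<close> unfolding inner_edges_def induced_edges_def by blast
  qed
  have card: "real (card (A i)) = (real (card (C i)) - real (card (C (i - 1)))) * (1 / L i)"
    if i: "i \<in> {1..t}" for i
  proof -
    have "real (card (A i)) * L i = real (card (C i)) - real (card (C (i - 1)))"
      unfolding C F_lt[OF i] F_le[OF i] A_def plateau_def
      using card_plateau[OF assms(3) E fin conn, of "L i"] unfolding ind .
    then show ?thesis using L_pos[OF i] by (simp add: field_simps)
  qed
  \<comment> \<open>Equal partitions would force an empty plateau by the count, but
    \<open>L i\<close> is the load of some edge.\<close>
  have proper: "C i \<noteq> C (i - 1)" if i: "i \<in> {1..t}" for i
  proof
    assume "C i = C (i - 1)"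
    then have "card (A i) = 0" using card[OF i] by simp
    moreover have "finite (A i)" using \<open>finite E\<close> by (simp add: A_def plateau_def)
    ultimately show False using L_edge[OF i] by (auto simp: A_def plateau_def)
  qed
  have refine: "refines V (C i) (C (i - 1))" if "i \<in> {1..t}" for i
    unfolding C using F_step[OF that] by (intro refines_conn_components) auto
  have "strict_mono_on {1..t} (\<lambda>i. 1 / L i)"
  proof (rule strict_mono_onI)
    fix i j assume "i \<in> {1..t}" "j \<in> {1..t}" "i < j"
    then show "1 / L i < 1 / L j"
      using L_less[of i j] L_pos[of j] by (intro divide_strict_left_mono) auto
  qed
  moreover have "C 0 = {V}" by (simp add: C_def plateau_chain_def)
  \<comment> \<open>As the inner edges of \<open>C (i - 1)\<close> are exactly
    \<open>F (i - 1)\<close>, deleting \<open>A i\<close> from them leaves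
    \<open>F i\<close>.\<close>
  moreover have "A i \<subseteq> inner_edges E (C (i - 1))"
    "C i = conn_components V (inner_edges E (C (i - 1)) - A i)" if i: "i \<in> {1..t}" for i
  proof -
    have "inner_edges E (C (i - 1)) = F (i - 1)" using i by (intro inner) auto
    then show "A i \<subseteq> inner_edges E (C (i - 1))"
      "C i = conn_components V (inner_edges E (C (i - 1)) - A i)"
      using A_F[OF i] F_step[OF i] C by simp_all
  qed
  ultimately have "principal_sequence V E t C A (\<lambda>i. 1 / L i)"
    unfolding principal_sequence_def using refine proper L_pos card by simp
  moreover have "\<exists>S. first_split_at E load \<D> (L i) S" if "i \<in> {1..t}" for i
    using L_edge[OF that] first_split_exists[OF assms(3) E fin, unfolded ind] by metis
  ultimately show ?thesis
    using card split_at_value(2)[OF assms(3)] unfolding C_def A_def by blast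
qed

end
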